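(* Let $X$ be a Banach space, $n\ge1$ and $1<p<\infty$. If the Rademacher maximal operator is $L^p$ bounded with respect to some dyadic system on $\mathbb{R}^n$, then it is $L^p$ bounded with respect to any dyadic system on $\mathbb{R}^n$. That is, if there exist $\beta\in(\{0,1\}^n)^{\mathbb{Z}}$ and a constant $C$ such that $\|\mathscr{M}^{\beta}f\|_{L^p}\le C\|f\|_{L^p(X)}$ for all $f\in L^p(X)$, then for every $\beta'\in(\{0,1\}^n)^{\mathbb{Z}}$ there is a constant $C'$ such that $\|\mathscr{M}^{\beta'}f\|_{L^p}\le C'\|f\|_{L^p(X)}$ for all $f\in L^p(X)$.
   Context: The dyadic systems on $\mathbb{R}^n$ are expressed through a parameter $\beta=(\beta_j)_{j\in\mathbb{Z}}\in(\{0,1\}^n)^{\mathbb{Z}}$: $\mathscr{D}^\beta=\bigcup_{k\in\mathbb{Z}}\mathscr{D}^\beta_k$ with $\mathscr{D}^\beta_k=\{2^{-k}([0,1)^n+m)+\sum_{j>k}2^{-j}\beta_j: m\in\mathbb{Z}^n\}$. The standard system is $\beta=0$. R-bound: let $(\varepsilon_k)$ be independent random variables taking values $+1$ and $-1$, each with probability $1/2$, and let $\mathbb{E}$ denote expectation. For $S\subset X$, the R-bound $\mathscr{R}(S)\in[0,\infty]$ is the smallest $C$ such that $\big(\mathbb{E}\|\sum_k\varepsilon_k\lambda_k\xi_k\|^2\big)^{1/2}\le C\big(\sum_k|\lambda_k|^2\big)^{1/2}$ for all finite families of vectors $\xi_k\in S$ and scalars $\lambda_k$ ($\mathscr{R}(S)=\infty$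 if no such $C$ exists). The Rademacher maximal function of a locally Bochner integrable $f:\mathbb{R}^n\to X$ with respect to $\mathscr{D}^\beta$ is $\mathscr{M}^\beta f(x)=\mathscr{R}(\langle f\rangle_Q: Q\in\mathscr{D}^\beta,\,Q\ni x)$, $x\in\mathbb{R}^n$, where $\langle f\rangle_Q=\frac{1}{|Q|}\int_Q f(y)\,dy$. $L^p(X)$ is the Lebesgue–Bochner space on $\mathbb{R}^n$. *)

theory Defs
  imports "HOL-Probability.Probability"
begin

text \<open>
  A Banach space is a type of class \<open>banach\<close> together with a scalar multiplication by a normed
  field \<open>'k\<close> that extends the real scalar multiplication and is compatible with the norm. By the
  Gelfand--Mazur theorem \<open>'k\<close> is the reals or the complex numbers, so that real and complex
  Banach spaces, with the corresponding scalars in the R-bound, are both covered.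
\<close>

definition banach_scalars :: "('k::real_normed_field \<Rightarrow> 'x::banach \<Rightarrow> 'x) \<Rightarrow> bool" where
  "banach_scalars smul \<longleftrightarrow>
     vector_space smul \<and>
     (\<forall>r x. smul (of_real r) x = r *\<^sub>R x) \<and>
     (\<forall>c x. norm (smul c x) = norm c * norm x)"

lemma banach_scalars_real: "banach_scalars (scaleR :: real \<Rightarrow> 'x::banach \<Rightarrow> 'x)"
  by (simp add: banach_scalars_def real_vector.vector_space_axioms)

lemma banach_scalars_complex: "banach_scalars ((*) :: complex \<Rightarrow> complex \<Rightarrow> complex)"
  by (auto simp: banach_scalars_def norm_mult scaleR_conv_of_real algebra_simps
      intro!: vector_space.intro)

text \<open>
  The library's Bochner integral is restricted to second countable target spaces. For an
  arbitrary Banach space, Borel measurability has to be replaced by strong measurability;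
  otherwise the definition below is that of \<open>has_bochner_integral\<close>.
\<close>

definition strongly_measurable :: "'a measure \<Rightarrow> ('a \<Rightarrow> 'x::real_normed_vector) \<Rightarrow> bool" where
  "strongly_measurable M f \<longleftrightarrow>
     (\<exists>s. (\<forall>i::nat. Bochner_Integration.simple_bochner_integrable M (s i)) \<and> (AE x in M. (\<lambda>i. s i x) \<longlonglongrightarrow> f x))"

definition has_strong_bochner_integral ::
    "'a measure \<Rightarrow> ('a \<Rightarrow> 'x::real_normed_vector) \<Rightarrow> 'x \<Rightarrow> bool" where
  "has_strong_bochner_integral M f I \<longleftrightarrow>
     strongly_measurable M f \<and>
     (\<exists>s. (\<forall>i::nat. Bochner_Integration.simple_bochner_integrable M (s i)) \<and>
          (\<lambda>i. \<integral>\<^sup>+x. norm (f x - s i x) \<partial>M) \<longlonglongrightarrow> 0 \<and>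
          (\<lambda>i. Bochner_Integration.simple_bochner_integral M (s i)) \<longlonglongrightarrow> I)"

definition strong_bochner_integral :: "'a measure \<Rightarrow> ('a \<Rightarrow> 'x::real_normed_vector) \<Rightarrow> 'x" where
  "strong_bochner_integral M f = (THE I. has_strong_bochner_integral M f I)"

lemma has_strong_bochner_integral_unique:
  fixes f :: "'a::euclidean_space \<Rightarrow> 'x::real_normed_vector"
  assumes "has_strong_bochner_integral lebesgue f I" "has_strong_bochner_integral lebesgue f J"
  shows "I = J"
proof -
  let ?int = "Bochner_Integration.simple_bochner_integrable lebesgue :: ('a \<Rightarrow> 'x) \<Rightarrow> bool"
  let ?I = "Bochner_Integration.simple_bochner_integral lebesgue :: ('a \<Rightarrow> 'x) \<Rightarrow> 'x"
  obtain u where u: "\<And>i::nat. ?int (u i)" "AE x in lebesgue. (\<lambda>i. u i x) \<longlonglongrightarrow> f x"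
    using assms(1) unfolding has_strong_bochner_integral_def strongly_measurable_def by auto
  obtain s where s: "\<And>i::nat. ?int (s i)"
      "(\<lambda>i. \<integral>\<^sup>+x. norm (f x - s i x) \<partial>lebesgue) \<longlonglongrightarrow> 0" "(\<lambda>i. ?I (s i)) \<longlonglongrightarrow> I"
    using assms(1) unfolding has_strong_bochner_integral_def by auto
  obtain t where t: "\<And>i::nat. ?int (t i)"
      "(\<lambda>i. \<integral>\<^sup>+x. norm (f x - t i x) \<partial>lebesgue) \<longlonglongrightarrow> 0" "(\<lambda>i. ?I (t i)) \<longlonglongrightarrow> J"
    using assms(2) unfolding has_strong_bochner_integral_def by auto
  have norm_diff: "Bochner_Integration.simple_bochner_integrable lebesgue (\<lambda>x. norm (g x - h x))"
    if "?int g" "?int h" for g h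
    using that by (rule simple_bochner_integrable_compose2[of "\<lambda>x y. norm (x - y)", rotated]) simp
  have meas [measurable]: "(\<lambda>x. norm (f x - h x)) \<in> borel_measurable lebesgue" if h: "?int h" for h
  proof (rule borel_measurable_AE)
    have "(\<lambda>x. norm (u i x - h x)) \<in> borel_measurable lebesgue" for i
      using norm_diff[OF u(1) h] borel_measurable_simple_function
      by (auto elim: simple_bochner_integrable.cases)
    then show "(\<lambda>x. lim (\<lambda>i. norm (u i x - h x))) \<in> borel_measurable lebesgue"
      by (rule borel_measurable_lim_metric)
    show "AE x in lebesgue. lim (\<lambda>i. norm (u i x - h x)) = norm (f x - h x)"
      using u(2) by eventually_elim (intro limI tendsto_intros)
  qed
  have bound: "ennreal (norm (?I (s i) - ?I (t i))) \<le>
    (\<integral>\<^sup>+x. norm (f x - s i x) \<partial>lebesgue) + (\<integral>\<^sup>+x. norm (f x - t i x) \<partial>lebesgue)" for i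
  proof -
    have "?I (s i) - ?I (t i) = ?I (\<lambda>x. s i x - t i x)"
      using s(1) t(1) by (simp add: simple_bochner_integral_diff)
    then have "ennreal (norm (?I (s i) - ?I (t i))) \<le>
        ennreal (Bochner_Integration.simple_bochner_integral lebesgue (\<lambda>x. norm (s i x - t i x)))"
      using simple_bochner_integrable_compose2[of "(-)" lebesgue "s i" "t i"] s(1) t(1)
      by (auto intro!: ennreal_leI simple_bochner_integral_norm_bound)
    also have "\<dots> = (\<integral>\<^sup>+x. norm (s i x - t i x) \<partial>lebesgue)"
      by (intro simple_bochner_integral_eq_nn_integral norm_diff s(1) t(1)) simp
    also have "\<dots> \<le> (\<integral>\<^sup>+x. ennreal (norm (f x - s i x)) + ennreal (norm (f x - t i x)) \<partial>lebesgue)"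
    proof (rule nn_integral_mono)
      fix x
      have "norm (s i x - t i x) \<le> norm (f x - s i x) + norm (f x - t i x)"
        by (rule norm_diff_triangle_le[of _ "f x"]) (simp_all add: norm_minus_commute)
      then show "ennreal (norm (s i x - t i x)) \<le> ennreal (norm (f x - s i x)) + ennreal (norm (f x - t i x))"
        by (simp flip: ennreal_plus)
    qed
    also have "\<dots> = (\<integral>\<^sup>+x. norm (f x - s i x) \<partial>lebesgue) + (\<integral>\<^sup>+x. norm (f x - t i x) \<partial>lebesgue)"
      using meas[OF s(1)] meas[OF t(1)] by (intro nn_integral_add) auto
    finally show ?thesis .
  qed
  have "(\<lambda>i. ennreal (norm (?I (s i) - ?I (t i)))) \<longlonglongrightarrow> ennreal 0"
    using tendsto_add[OF s(2) t(2)]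
    by (intro tendsto_sandwich[OF _ always_eventually[OF allI[OF bound]], of "\<lambda>_. 0"]) auto
  then have "(\<lambda>i. norm (?I (s i) - ?I (t i))) \<longlonglongrightarrow> 0"
    by (simp flip: ennreal_0)
  moreover have "(\<lambda>i. norm (?I (s i) - ?I (t i))) \<longlonglongrightarrow> norm (I - J)"
    using s(3) t(3) by (intro tendsto_intros)
  ultimately have "0 = norm (I - J)"
    by (rule LIMSEQ_unique)
  then show ?thesis
    by simp
qed

lemma strong_bochner_integral_eq_lebesgue_integral:
  fixes f :: "'a::euclidean_space \<Rightarrow> 'x::{banach, second_countable_topology}"
  assumes "integrable lebesgue f"
  shows "strong_bochner_integral lebesgue f = integral\<^sup>L lebesgue f"
proof -
  have f: "has_bochner_integral lebesgue f (integral\<^sup>L lebesgue f)"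
    using assms by (rule has_bochner_integral_integrable)
  have fm: "f \<in> borel_measurable lebesgue" and fin: "(\<integral>\<^sup>+x. norm (f x) \<partial>lebesgue) < \<infinity>"
    using assms by (auto simp: integrable_iff_bounded)
  from borel_measurable_implies_sequence_metric[OF fm, of 0] obtain u
    where u: "\<And>i. simple_function lebesgue (u i)" "\<And>x. (\<lambda>i. u i x) \<longlonglongrightarrow> f x"
      "\<And>i x. norm (u i x) \<le> 2 * norm (f x)"
    by auto
  have "Bochner_Integration.simple_bochner_integrable lebesgue (u i)" for i
  proof (rule simple_bochner_integrableI_bounded[OF u(1)])
    have "(\<integral>\<^sup>+x. norm (u i x) \<partial>lebesgue) \<le> (\<integral>\<^sup>+x. ennreal 2 * norm (f x) \<partial>lebesgue)"
      using ennreal_leI[OF u(3)] by (intro nn_integral_mono) (simp add: ennreal_mult)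
    also have "\<dots> = ennreal 2 * (\<integral>\<^sup>+x. norm (f x) \<partial>lebesgue)"
      using fm by (intro nn_integral_cmult) auto
    also have "\<dots> < \<infinity>"
      using fin by (simp add: ennreal_mult_less_top)
    finally show "(\<integral>\<^sup>+x. norm (u i x) \<partial>lebesgue) < \<infinity>" .
  qed
  with u(2) have "strongly_measurable lebesgue f"
    unfolding strongly_measurable_def by auto
  with f have "has_strong_bochner_integral lebesgue f (integral\<^sup>L lebesgue f)"
    unfolding has_strong_bochner_integral_def has_bochner_integral.simps by blast
  then show ?thesis
    unfolding strong_bochner_integral_def
    using has_strong_bochner_integral_unique by (intro the_equality) blast+
qed

definition average :: "('a::euclidean_space \<Rightarrow> 'x::real_normed_vector) \<Rightarrow> 'a set \<Rightarrow> 'x" where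
  "average f Q =
     (1 / measure lebesgue Q) *\<^sub>R strong_bochner_integral lebesgue (\<lambda>y. indicator Q y *\<^sub>R f y)"

definition ennreal_powr :: "ennreal \<Rightarrow> real \<Rightarrow> ennreal" where
  "ennreal_powr a p = (if a = \<top> then \<top> else ennreal (enn2real a powr p))"

text \<open>The usual \<open>L\<^sup>p\<close> norm for \<open>0 < p < \<infinity>\<close> only.\<close>

definition lp_norm :: "real \<Rightarrow> ('a::euclidean_space \<Rightarrow> ennreal) \<Rightarrow> ennreal" where
  "lp_norm p g = ennreal_powr (\<integral>\<^sup>+x. ennreal_powr (g x) p \<partial>lebesgue) (1 / p)"

definition bochner_lp_norm :: "real \<Rightarrow> ('a::euclidean_space \<Rightarrow> 'x::real_normed_vector) \<Rightarrow> ennreal" where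
  "bochner_lp_norm p f = lp_norm p (\<lambda>x. ennreal (norm (f x)))"

definition bochner_lp :: "real \<Rightarrow> ('a::euclidean_space \<Rightarrow> 'x::real_normed_vector) set" where
  "bochner_lp p = {f. strongly_measurable lebesgue f \<and> bochner_lp_norm p f < \<top>}"

text \<open>
  The joint distribution of \<open>N\<close> independent random signs; under \<open>Pi_pmf\<close> the coordinates
  \<open>\<epsilon> k\<close>, \<open>k < N\<close>, are independent (the default value \<open>0\<close> is only taken for \<open>k \<ge> N\<close>).
\<close>

definition rademacher_pmf :: "nat \<Rightarrow> (nat \<Rightarrow> real) pmf" where
  "rademacher_pmf N = Pi_pmf {..<N} 0 (\<lambda>_. pmf_of_set {-1, 1})"

text \<open>The constant \<open>\<top>\<close> always qualifies, so the infimum is \<open>\<top>\<close> iff no finite constant does.\<close>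

definition R_bound :: "('k::real_normed_field \<Rightarrow> 'x::banach \<Rightarrow> 'x) \<Rightarrow> 'x set \<Rightarrow> ennreal" where
  "R_bound smul S =
     Inf {C. \<forall>(N::nat) (\<xi>::nat \<Rightarrow> 'x) (a::nat \<Rightarrow> 'k). (\<forall>k<N. \<xi> k \<in> S) \<longrightarrow>
       ennreal (sqrt (measure_pmf.expectation (rademacher_pmf N)
          (\<lambda>\<epsilon>. (norm (\<Sum>k<N. \<epsilon> k *\<^sub>R smul (a k) (\<xi> k)))\<^sup>2)))
       \<le> C * ennreal (sqrt (\<Sum>k<N. (norm (a k))\<^sup>2))}"

definition dyadic_params :: "(int \<Rightarrow> real ^ 'n) set" where
  "dyadic_params = {\<beta>. \<forall>j i. \<beta> j $ i \<in> {0, 1}}"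

definition dyadic_shift :: "(int \<Rightarrow> real ^ 'n) \<Rightarrow> int \<Rightarrow> real ^ 'n" where
  "dyadic_shift \<beta> k = (\<Sum>\<^sub>\<infinity>j\<in>{k<..}. (2 powi (-j)) *\<^sub>R \<beta> j)"

definition half_open_unit_cube :: "(real ^ 'n) set" where
  "half_open_unit_cube = {y. \<forall>i. 0 \<le> y $ i \<and> y $ i < 1}"

definition dyadic_cubes :: "(int \<Rightarrow> real ^ 'n) \<Rightarrow> int \<Rightarrow> (real ^ 'n) set set" where
  "dyadic_cubes \<beta> k =
     {(\<lambda>y. (2 powi (-k)) *\<^sub>R (y + m) + dyadic_shift \<beta> k) ` half_open_unit_cube | m. \<forall>i. m $ i \<in> \<int>}"

definition dyadic_system :: "(int \<Rightarrow> real ^ 'n) \<Rightarrow> (real ^ 'n) set set" where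
  "dyadic_system \<beta> = (\<Union>k. dyadic_cubes \<beta> k)"

definition rademacher_maximal ::
    "('k::real_normed_field \<Rightarrow> 'x::banach \<Rightarrow> 'x) \<Rightarrow> (int \<Rightarrow> real ^ 'n) \<Rightarrow>
     (real ^ 'n \<Rightarrow> 'x) \<Rightarrow> real ^ 'n \<Rightarrow> ennreal" where
  "rademacher_maximal smul \<beta> f x = R_bound smul {average f Q | Q. Q \<in> dyadic_system \<beta> \<and> x \<in> Q}"

definition rademacher_maximal_lp_bounded ::
    "('k::real_normed_field \<Rightarrow> 'x::banach \<Rightarrow> 'x) \<Rightarrow> real \<Rightarrow> (int \<Rightarrow> real ^ 'n) \<Rightarrow> bool" where
  "rademacher_maximal_lp_bounded smul p \<beta> \<longleftrightarrow>
     (\<exists>C\<ge>0::real. \<forall>f\<in>bochner_lp p.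
        lp_norm p (rademacher_maximal smul \<beta> f) \<le> ennreal C * bochner_lp_norm p f)"

end

(*
  On generations k >= l every dyadic system is a translate of the standard one: the terms
  2^-j beta_j with l < j <= k of the shift lie in 2^-k Z^n, so that the cubes of generation k are
  2^-k ([0,1)^n + m) + s_l, where s_l is the shift of generation l. Hence the maximal function
  truncated to the generations -K..K depends on the system only through a translation, under which
  the Lebesgue measure is invariant. The full maximal function is the increasing limit of the
  truncated ones, and monotone convergence gives the same constant for all systems.
*)
theory Submission
  imports Defs
begin

section \<open>Translation invariance of measure, integrals, averages and L^p norms\<close>

lemma measurable_lebesgue_plus: "(+) (t :: 'a::euclidean_space) \<in> lebesgue \<rightarrow>\<^sub>M lebesgue"
proof -
  have "(\<lambda>x. t + (\<Sum>j\<in>Basis. (1 * (x \<bullet> j)) *\<^sub>R j)) = (+) t"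
    by (simp add: euclidean_representation fun_eq_iff)
  then show ?thesis
    using lebesgue_affine_measurable[of "\<lambda>_. 1" t] by simp
qed

lemma distr_lebesgue_plus: "distr lebesgue lebesgue ((+) (t :: 'a::euclidean_space)) = lebesgue"
proof -
  have *: "(\<lambda>x. t + (\<Sum>j\<in>Basis. (1 * (x \<bullet> j)) *\<^sub>R j)) = (+) t"
    by (simp add: euclidean_representation fun_eq_iff)
  \<comment> \<open>The translation is the affine map with all scaling factors 1, so the Jacobian
    density is the constant 1.\<close>
  have "density (distr lebesgue lebesgue ((+) t)) (\<lambda>_. 1) = lebesgue"
    using lebesgue_affine_euclidean[of "\<lambda>_. 1" t, symmetric] unfolding * by simp
  then show ?thesis
    by (simp add: density_1)
qed

lemma emeasure_lebesgue_plus_vimage: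
  fixes t :: "'a::euclidean_space"
  assumes "A \<in> sets lebesgue"
  shows "emeasure lebesgue {x. t + x \<in> A} = emeasure lebesgue A"
proof -
  have "emeasure lebesgue A = emeasure (distr lebesgue lebesgue ((+) t)) A"
    by (simp add: distr_lebesgue_plus)
  also have "\<dots> = emeasure lebesgue {x. t + x \<in> A}"
    using assms measurable_lebesgue_plus[of t] by (subst emeasure_distr) (auto simp: vimage_def)
  finally show ?thesis by simp
qed

lemma AE_lebesgue_plus:
  fixes t :: "'a::euclidean_space"
  assumes "AE x in lebesgue. P x"
  shows "AE x in lebesgue. P (t + x)"
proof (rule AE_distrD[OF measurable_lebesgue_plus[of t]])
  show "AE x in distr lebesgue lebesgue ((+) t). P x"
    using assms by (simp only: distr_lebesgue_plus)
qed

lemma simple_function_lebesgue_plus: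
  fixes t :: "'a::euclidean_space"
  assumes "simple_function lebesgue s"
  shows "simple_function lebesgue (\<lambda>x. s (t + x))"
  using measurable_lebesgue_plus assms by (rule simple_function_comp)

text \<open>The function \<open>f\<close> is arbitrary, so the change of variables is made only for
  the simple functions below it. This gives one inequality; the other is the same inequality for the
  translated function and \<open>- t\<close>.\<close>

lemma nn_integral_lebesgue_plus:
  fixes t :: "'a::euclidean_space"
  shows "(\<integral>\<^sup>+x. f (t + x) \<partial>lebesgue) = (\<integral>\<^sup>+x. f x \<partial>lebesgue)"
proof -
  have le: "(\<integral>\<^sup>+x. f x \<partial>lebesgue) \<le> (\<integral>\<^sup>+x. f (t + x) \<partial>lebesgue)" for f and t :: 'a
    unfolding nn_integral_def[of lebesgue f]
  proof (rule SUP_least, safe)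
    fix g assume g: "simple_function lebesgue g" "g \<le> f"
    have "integral\<^sup>S lebesgue g = (\<integral>\<^sup>+x. g x \<partial>distr lebesgue lebesgue ((+) t))"
      using g(1) by (simp add: distr_lebesgue_plus nn_integral_eq_simple_integral)
    also have "\<dots> = (\<integral>\<^sup>+x. g (t + x) \<partial>lebesgue)"
      using measurable_lebesgue_plus borel_measurable_simple_function[OF g(1)]
      by (intro nn_integral_distr) auto
    also have "\<dots> \<le> (\<integral>\<^sup>+x. f (t + x) \<partial>lebesgue)"
      using g(2) by (intro nn_integral_mono) (auto simp: le_fun_def)
    finally show "integral\<^sup>S lebesgue g \<le> (\<integral>\<^sup>+x. f (t + x) \<partial>lebesgue)" .
  qed
  show ?thesis
    using le[of f t] le[of "\<lambda>x. f (t + x)" "- t"] by simp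
qed

lemma simple_bochner_integrable_lebesgue_plus:
  fixes t :: "'a::euclidean_space"
  assumes "Bochner_Integration.simple_bochner_integrable lebesgue s"
  shows "Bochner_Integration.simple_bochner_integrable lebesgue (\<lambda>x. s (t + x))"
  using assms
proof cases
  case 1
  have "{y. s y \<noteq> 0} \<in> sets lebesgue"
    using simple_functionD(2)[OF 1(1), of "- {0}"] by (simp add: vimage_def)
  with 1 show ?thesis
    using emeasure_lebesgue_plus_vimage[of "{y. s y \<noteq> 0}" t]
    by (intro simple_bochner_integrable.intros simple_function_lebesgue_plus) simp_all
qed

text \<open>The integral is a finite sum of values weighted by the measures of their level sets, and
  translation keeps both the range and these measures.\<close>

lemma simple_bochner_integral_lebesgue_plus:
  fixes t :: "'a::euclidean_space"
  assumes "simple_function lebesgue s"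
  shows "Bochner_Integration.simple_bochner_integral lebesgue (\<lambda>x. s (t + x)) =
    Bochner_Integration.simple_bochner_integral lebesgue s"
proof -
  have "range (\<lambda>x. s (t + x)) = range s"
    using surj_plus[of t] by (metis image_image)
  moreover have "measure lebesgue {x. s (t + x) = y} = measure lebesgue {x. s x = y}" for y
    using emeasure_lebesgue_plus_vimage[of "{x. s x = y}" t] simple_functionD(2)[OF assms, of "{y}"]
    by (simp add: measure_def vimage_def)
  ultimately show ?thesis
    by (simp add: simple_bochner_integral_def)
qed

lemma strongly_measurable_lebesgue_plus:
  fixes t :: "'a::euclidean_space"
  assumes "strongly_measurable lebesgue f"
  shows "strongly_measurable lebesgue (\<lambda>x. f (t + x))"
proof -
  from assms obtain s :: "nat \<Rightarrow> _"
    where s: "\<And>i. Bochner_Integration.simple_bochner_integrable lebesgue (s i)"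
      "AE x in lebesgue. (\<lambda>i. s i x) \<longlonglongrightarrow> f x"
    unfolding strongly_measurable_def by auto
  then show ?thesis
    unfolding strongly_measurable_def
    using simple_bochner_integrable_lebesgue_plus AE_lebesgue_plus[OF s(2)]
    by (intro exI[of _ "\<lambda>i x. s i (t + x)"]) auto
qed

lemma has_strong_bochner_integral_lebesgue_plus:
  fixes t :: "'a::euclidean_space"
  assumes "has_strong_bochner_integral lebesgue f I"
  shows "has_strong_bochner_integral lebesgue (\<lambda>x. f (t + x)) I"
proof -
  from assms obtain s :: "nat \<Rightarrow> _"
    where s: "\<And>i. Bochner_Integration.simple_bochner_integrable lebesgue (s i)"
      "(\<lambda>i. \<integral>\<^sup>+x. norm (f x - s i x) \<partial>lebesgue) \<longlonglongrightarrow> 0"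
      "(\<lambda>i. Bochner_Integration.simple_bochner_integral lebesgue (s i)) \<longlonglongrightarrow> I"
    unfolding has_strong_bochner_integral_def by auto
  have "simple_function lebesgue (s i)" for i
    using s(1) by (rule simple_bochner_integrable.cases)
  with s show ?thesis
    unfolding has_strong_bochner_integral_def
    using assms nn_integral_lebesgue_plus[of "\<lambda>x. ennreal (norm (f x - s _ x))" t]
    by (auto simp: has_strong_bochner_integral_def simple_bochner_integral_lebesgue_plus
        intro!: exI[of _ "\<lambda>i x. s i (t + x)"] strongly_measurable_lebesgue_plus
        simple_bochner_integrable_lebesgue_plus)
qed

lemma strong_bochner_integral_lebesgue_plus:
  fixes t :: "'a::euclidean_space"
  shows "strong_bochner_integral lebesgue (\<lambda>x. f (t + x)) = strong_bochner_integral lebesgue f"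
proof -
  \<comment> \<open>The equivalence for every \<open>I\<close> makes the two \<open>THE\<close>
    descriptions coincide even when no integral exists.\<close>
  have "has_strong_bochner_integral lebesgue (\<lambda>x. f (t + x)) I \<longleftrightarrow>
      has_strong_bochner_integral lebesgue f I" for I
    using has_strong_bochner_integral_lebesgue_plus[of f I t]
      has_strong_bochner_integral_lebesgue_plus[of "\<lambda>x. f (t + x)" I "- t"] by auto
  then show ?thesis
    by (simp add: strong_bochner_integral_def)
qed

lemma average_plus_image:
  fixes t :: "'a::euclidean_space"
  shows "average f ((+) t ` Q) = average (\<lambda>x. f (t + x)) Q"
proof -
  have "indicator ((+) t ` Q) (t + y) = (indicator Q y :: real)" for y
    by (auto simp: indicator_def)
  then have "strong_bochner_integral lebesgue (\<lambda>y. indicator ((+) t ` Q) y *\<^sub>R f y) =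
      strong_bochner_integral lebesgue (\<lambda>y. indicator Q y *\<^sub>R f (t + y))"
    using strong_bochner_integral_lebesgue_plus[of "\<lambda>y. indicator ((+) t ` Q) y *\<^sub>R f y" t] by simp
  then show ?thesis
    by (simp add: average_def measure_translation)
qed

lemma bochner_lp_norm_plus:
  "bochner_lp_norm p (\<lambda>x. f (t + x)) = bochner_lp_norm p f"
  by (simp add: bochner_lp_norm_def lp_norm_def
      nn_integral_lebesgue_plus[of "\<lambda>x. ennreal_powr (ennreal (norm (f x))) p"])

lemma bochner_lp_plus:
  "f \<in> bochner_lp p \<Longrightarrow> (\<lambda>x. f (t + x)) \<in> bochner_lp p"
  by (simp add: bochner_lp_def bochner_lp_norm_plus strongly_measurable_lebesgue_plus)

section \<open>Powers of extended reals and the L^p norm\<close>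

lemma ennreal_powr_mono: "0 \<le> p \<Longrightarrow> a \<le> b \<Longrightarrow> ennreal_powr a p \<le> ennreal_powr b p"
  by (auto simp: ennreal_powr_def top_unique less_top intro!: ennreal_leI powr_mono2 enn2real_mono)

lemma ennreal_powr_inverse: "0 < p \<Longrightarrow> ennreal_powr (ennreal_powr a p) (1 / p) = a"
  by (simp add: ennreal_powr_def powr_powr less_top)

text \<open>Powers with exponents \<open>p\<close> and \<open>1 / p\<close> are monotone and
  mutually inverse. In this adjoint form the statement yields both the passage of powers through
  suprema and the removal of the outer root in \<open>lp_norm\<close>.\<close>

lemma ennreal_powr_le_iff:
  assumes "0 < p"
  shows "ennreal_powr a p \<le> b \<longleftrightarrow> a \<le> ennreal_powr b (1 / p)"
proof
  show "a \<le> ennreal_powr b (1 / p)" if "ennreal_powr a p \<le> b"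
    using ennreal_powr_mono[OF _ that, of "1 / p"] assms by (simp add: ennreal_powr_inverse)
  show "ennreal_powr a p \<le> b" if "a \<le> ennreal_powr b (1 / p)"
    using ennreal_powr_mono[OF _ that, of p] ennreal_powr_inverse[of "1 / p" b] assms by simp
qed

lemma ennreal_powr_SUP:
  assumes "0 < p"
  shows "ennreal_powr (SUP i\<in>I. a i) p = (SUP i\<in>I. ennreal_powr (a i) p)"
proof (rule antisym)
  show "ennreal_powr (SUP i\<in>I. a i) p \<le> (SUP i\<in>I. ennreal_powr (a i) p)"
    unfolding ennreal_powr_le_iff[OF assms]
    by (intro SUP_least) (auto intro: SUP_upper simp flip: ennreal_powr_le_iff[OF assms])
  show "(SUP i\<in>I. ennreal_powr (a i) p) \<le> ennreal_powr (SUP i\<in>I. a i) p"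
    using assms by (intro SUP_least ennreal_powr_mono SUP_upper) auto
qed

lemma lp_norm_le_iff:
  assumes "0 < p"
  shows "lp_norm p g \<le> D \<longleftrightarrow> (\<integral>\<^sup>+x. ennreal_powr (g x) p \<partial>lebesgue) \<le> ennreal_powr D p"
  using assms ennreal_powr_le_iff[of "1 / p"] by (simp add: lp_norm_def)

section \<open>R-bounds of increasing unions\<close>

lemma R_bound_mono: "S \<subseteq> T \<Longrightarrow> R_bound smul S \<le> R_bound smul T"
  unfolding R_bound_def by (rule Inf_superset_mono) blast

text \<open>Admissible constants are closed upwards, so everything strictly above their infimum is
  admissible; whether the infimum is attained need not be decided.\<close>

lemma R_bound_less_imp_le:
  fixes smul :: "'k::real_normed_field \<Rightarrow> 'x::banach \<Rightarrow> 'x"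
  assumes "R_bound smul S < c" "\<forall>k<N. \<xi> k \<in> S"
  shows "ennreal (sqrt (measure_pmf.expectation (rademacher_pmf N)
      (\<lambda>\<epsilon>. (norm (\<Sum>k<N. \<epsilon> k *\<^sub>R smul (a k) (\<xi> k)))\<^sup>2))) \<le> c * ennreal (sqrt (\<Sum>k<N. (norm (a k))\<^sup>2))"
    (is "?A N \<xi> a \<le> c * ?B N a")
proof -
  from assms(1) obtain C
    where "C < c" and C: "\<forall>N \<xi> a. (\<forall>k<N. \<xi> k \<in> S) \<longrightarrow> ?A N \<xi> a \<le> C * ?B N a"
    unfolding R_bound_def Inf_less_iff by (elim bexE CollectE)
  have "?A N \<xi> a \<le> C * ?B N a"
    using C assms(2) by simp
  also have "\<dots> \<le> c * ?B N a"
    using \<open>C < c\<close> by (intro mult_right_mono) auto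
  finally show ?thesis .
qed

text \<open>A finite family in the union already lies in one of the sets.\<close>

lemma R_bound_UN_incseq:
  fixes smul :: "'k::real_normed_field \<Rightarrow> 'x::banach \<Rightarrow> 'x" and S :: "nat \<Rightarrow> 'x set"
  assumes "incseq S"
  shows "R_bound smul (\<Union>K. S K) = (SUP K. R_bound smul (S K))"
proof (rule antisym)
  show "(SUP K. R_bound smul (S K)) \<le> R_bound smul (\<Union>K. S K)"
    by (intro SUP_least R_bound_mono) auto
  show "R_bound smul (\<Union>K. S K) \<le> (SUP K. R_bound smul (S K))"
  proof (rule dense_ge)
    fix c assume c: "(SUP K. R_bound smul (S K)) < c"
    show "R_bound smul (\<Union>K. S K) \<le> c"
      unfolding R_bound_def[of smul "\<Union>K. S K"]
    proof (rule Inf_lower, rule CollectI, intro allI impI)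
      fix N :: nat and \<xi> :: "nat \<Rightarrow> 'x" and a :: "nat \<Rightarrow> 'k"
      assume \<xi>: "\<forall>k<N. \<xi> k \<in> (\<Union>K. S K)"
      have "\<forall>k. \<exists>K. k < N \<longrightarrow> \<xi> k \<in> S K"
        using \<xi> by blast
      from choice[OF this] obtain K where K: "\<And>k. k < N \<Longrightarrow> \<xi> k \<in> S (K k)"
        by auto
      \<comment> \<open>The largest of the finitely many indices serves for the whole family. For
        \<open>N = 0\<close> the \<open>Max\<close> of the empty set is unspecified, but then
        nothing has to be in the set.\<close>
      have *: "\<xi> k \<in> S (Max (K ` {..<N}))" if "k < N" for k
        using K[OF that] incseqD[OF assms, of "K k" "Max (K ` {..<N})"] that by auto
      show "ennreal (sqrt (measure_pmf.expectation (rademacher_pmf N)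
          (\<lambda>\<epsilon>. (norm (\<Sum>k<N. \<epsilon> k *\<^sub>R smul (a k) (\<xi> k)))\<^sup>2))) \<le>
        c * ennreal (sqrt (\<Sum>k<N. (norm (a k))\<^sup>2))"
      proof (rule R_bound_less_imp_le[where smul = smul and a = a and \<xi> = \<xi>])
        show "R_bound smul (S (Max (K ` {..<N}))) < c"
          using c by (rule le_less_trans[OF SUP_upper[OF UNIV_I]])
        show "\<forall>k<N. \<xi> k \<in> S (Max (K ` {..<N}))"
          using * by blast
      qed
    qed
  qed
qed

section \<open>Dyadic shifts and cubes\<close>

lemma dyadic_shift_summable:
  assumes "\<beta> \<in> dyadic_params"
  shows "(\<lambda>j. (2 powi (- j)) *\<^sub>R (\<beta> j :: real ^ 'n)) summable_on {l<..}"
proof -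
  \<comment> \<open>Enumerating the indices \<open>j > l\<close> from \<open>l + 1\<close> allows
    comparison with a geometric series; its factor \<open>CARD('n)\<close> bounds the l^1 norm of a
    vector with entries 0 and 1.\<close>
  define h where "h n = l + 1 + int n" for n
  have "{l<..} = h ` UNIV"
  proof safe
    fix j assume "l < j"
    then have "j = h (nat (j - l - 1))" by (simp add: h_def)
    then show "j \<in> range h" by blast
  qed (simp add: h_def)
  moreover have "inj h"
    by (auto simp: h_def inj_def)
  moreover have "((\<lambda>j. (2 powi (- j)) *\<^sub>R \<beta> j) \<circ> h) summable_on UNIV"
  proof (rule norm_summable_imp_summable_on, rule summable_comparison_test')
    show "summable (\<lambda>n. 2 powi (- l - 1) * real CARD('n) * (1 / 2) ^ n)"
      by (intro summable_mult summable_geometric) simp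
    fix n :: nat assume "0 \<le> n"
    have \<beta>: "\<bar>\<beta> j $ i\<bar> \<le> 1" for j i
    proof -
      have "\<beta> j $ i \<in> {0, 1}" using assms unfolding dyadic_params_def by blast
      then show ?thesis by auto
    qed
    have "norm (\<beta> j) \<le> real CARD('n)" for j
      using norm_le_l1_cart[of "\<beta> j"] sum_bounded_above[of UNIV "\<lambda>i. \<bar>\<beta> j $ i\<bar>" 1] \<beta> by simp
    moreover have "(2::real) powi (- h n) = 2 powi (- l - 1) * (1 / 2) ^ n"
      unfolding h_def
      by (simp add: power_int_diff power_int_minus power_int_add field_simps)
    ultimately show "norm (norm (((\<lambda>j. (2 powi (- j)) *\<^sub>R \<beta> j) \<circ> h) n)) \<le>
        2 powi (- l - 1) * real CARD('n) * (1 / 2) ^ n"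
      by (simp add: mult_left_mono mult_right_mono)
  qed
  ultimately show ?thesis
    by (simp add: summable_on_reindex)
qed

lemma dyadic_shift_split:
  assumes "\<beta> \<in> dyadic_params" "l \<le> k"
  shows "dyadic_shift \<beta> l = (\<Sum>j\<in>{l<..k}. (2 powi (- j)) *\<^sub>R \<beta> j) + dyadic_shift \<beta> k"
proof -
  have *: "{l<..} = {l<..k} \<union> {k<..}"
    using assms(2) by auto
  show ?thesis
    unfolding dyadic_shift_def *
    using dyadic_shift_summable[OF assms(1)] by (subst infsum_Un_disjoint) auto
qed

text \<open>Replacing the shift of generation \<open>k\<close> by that of the coarser generation
  \<open>l\<close> changes the offset by a vector of the lattice \<open>2^-k Z^n\<close>, which is
  absorbed into \<open>m\<close>.\<close>

lemma dyadic_cubes_eq: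
  fixes \<beta> :: "int \<Rightarrow> real ^ 'n"
  assumes "\<beta> \<in> dyadic_params" "l \<le> k"
  shows "dyadic_cubes \<beta> k =
    (\<lambda>m. (\<lambda>y. (2 powi (- k)) *\<^sub>R (y + m) + dyadic_shift \<beta> l) ` half_open_unit_cube) `
      {m. \<forall>i. m $ i \<in> \<int>}"
proof -
  \<comment> \<open>The difference of the two shifts in units of \<open>2^-k\<close>. It is integral
    because \<open>2 powi (k - j)\<close> is an integer for \<open>j \<le> k\<close>.\<close>
  define d where "d = (\<Sum>j\<in>{l<..k}. (2 powi (k - j)) *\<^sub>R \<beta> j)"
  have "\<beta> j $ i \<in> \<int>" for j i
  proof -
    have "\<beta> j $ i \<in> {0, 1}" using assms(1) unfolding dyadic_params_def by blast
    then show ?thesis by auto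
  qed
  moreover have "(2::real) powi (k - j) \<in> \<int>" if "j \<le> k" for j
    using that by (simp add: power_int_def)
  ultimately have d: "d $ i \<in> \<int>" for i
    unfolding d_def by (auto intro!: Ints_sum Ints_mult)
  have "(2 powi (- k)) *\<^sub>R d = (\<Sum>j\<in>{l<..k}. (2 powi (- j)) *\<^sub>R \<beta> j)"
    unfolding d_def scaleR_sum_right
    by (intro sum.cong refl) (simp flip: power_int_add)
  then have shift: "dyadic_shift \<beta> l = (2 powi (- k)) *\<^sub>R d + dyadic_shift \<beta> k"
    using dyadic_shift_split[OF assms] by simp
  let ?F = "\<lambda>m s. (\<lambda>y. (2 powi (- k)) *\<^sub>R (y + m) + s) ` half_open_unit_cube"
  have F: "?F m (dyadic_shift \<beta> l) = ?F (m + d) (dyadic_shift \<beta> k)" for m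
    by (simp add: shift algebra_simps)
  let ?Z = "{m :: real ^ 'n. \<forall>i. m $ i \<in> \<int>}"
  have "m \<in> (\<lambda>m. m + d) ` ?Z" if "m \<in> ?Z" for m
    using that d by (intro image_eqI[of _ _ "m - d"]) auto
  moreover have "m + d \<in> ?Z" if "m \<in> ?Z" for m
    using that d by auto
  \<comment> \<open>Adding the integral vector \<open>d\<close> permutes the lattice, so reindexing
    by \<open>m + d\<close> loses no cube.\<close>
  ultimately have "?Z = (\<lambda>m. m + d) ` ?Z"
    by blast
  moreover have "dyadic_cubes \<beta> k = (\<lambda>m. ?F m (dyadic_shift \<beta> k)) ` ?Z"
    unfolding dyadic_cubes_def by (rule image_Collect[symmetric])
  ultimately have "dyadic_cubes \<beta> k = (\<lambda>m. ?F m (dyadic_shift \<beta> k)) ` (\<lambda>m. m + d) ` ?Z"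
    by metis
  then show ?thesis
    by (simp only: image_image[of _ "\<lambda>m. m + d"] F)
qed

text \<open>With the offset taken at \<open>l\<close>, the two systems differ only in that offset.
  The translation vector does not depend on \<open>k\<close>, so one translation serves all
  generations \<open>k \<ge> l\<close>.\<close>

lemma dyadic_cubes_translate:
  fixes \<beta> \<beta>' :: "int \<Rightarrow> real ^ 'n"
  assumes "\<beta> \<in> dyadic_params" "\<beta>' \<in> dyadic_params" "l \<le> k"
  shows "dyadic_cubes \<beta>' k = (`) ((+) (dyadic_shift \<beta>' l - dyadic_shift \<beta> l)) ` dyadic_cubes \<beta> k"
  unfolding dyadic_cubes_eq[OF assms(1,3)] dyadic_cubes_eq[OF assms(2,3)] image_image
  by (intro image_cong refl) (simp add: add.commute)

section \<open>Truncation to finitely many generations\<close>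

text \<open>Both cutoffs matter: without generations below \<open>-K\<close> a single translation
  relates two systems, and without generations above \<open>K\<close> the set depends only on the
  generation-\<open>K\<close> cube containing \<open>x\<close>.\<close>

definition truncated_averages ::
    "(int \<Rightarrow> real ^ 'n) \<Rightarrow> (real ^ 'n \<Rightarrow> 'x::real_normed_vector) \<Rightarrow> nat \<Rightarrow> real ^ 'n \<Rightarrow> 'x set" where
  "truncated_averages \<beta> f K x =
     {average f Q | Q k. \<bar>k\<bar> \<le> int K \<and> Q \<in> dyadic_cubes \<beta> k \<and> x \<in> Q}"

lemma incseq_truncated_averages: "incseq (\<lambda>K. truncated_averages \<beta> f K x)"
proof (rule incseq_SucI)
  have "\<bar>k\<bar> \<le> int (Suc K)" if "\<bar>k\<bar> \<le> int K" for k K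
    using that by simp
  then show "truncated_averages \<beta> f K x \<subseteq> truncated_averages \<beta> f (Suc K) x" for K
    unfolding truncated_averages_def by blast
qed

lemma UN_truncated_averages:
  "(\<Union>K. truncated_averages \<beta> f K x) = {average f Q | Q. Q \<in> dyadic_system \<beta> \<and> x \<in> Q}"
proof -
  have "\<exists>K. \<bar>k\<bar> \<le> int K" for k :: int
    by (rule exI[of _ "nat \<bar>k\<bar>"]) simp
  then show ?thesis
    unfolding truncated_averages_def dyadic_system_def by blast
qed

lemma rademacher_maximal_eq_SUP:
  "rademacher_maximal smul \<beta> f x = (SUP K. R_bound smul (truncated_averages \<beta> f K x))"
  unfolding rademacher_maximal_def
  by (simp add: R_bound_UN_incseq incseq_truncated_averages flip: UN_truncated_averages)

text \<open>The coarsest generation present is \<open>-K\<close>, so translation by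
  \<open>t K\<close> matches all cubes involved and can be moved from the cubes to \<open>f\<close>.
  The vectors \<open>t K\<close> may be unbounded in \<open>K\<close>.\<close>

lemma truncated_averages_translate:
  fixes \<beta> \<beta>' :: "int \<Rightarrow> real ^ 'n"
  assumes "\<beta> \<in> dyadic_params" "\<beta>' \<in> dyadic_params"
  defines "t \<equiv> \<lambda>K. dyadic_shift \<beta>' (- int K) - dyadic_shift \<beta> (- int K)"
  shows "truncated_averages \<beta>' f K (t K + x) = truncated_averages \<beta> (\<lambda>y. f (t K + y)) K x"
proof -
  have cubes: "dyadic_cubes \<beta>' k = (`) ((+) (t K)) ` dyadic_cubes \<beta> k" if "\<bar>k\<bar> \<le> int K" for k
    unfolding t_def using that by (intro dyadic_cubes_translate assms(1,2)) simp
  have mem: "t K + x \<in> (+) (t K) ` Q \<longleftrightarrow> x \<in> Q" for Q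
    by (simp add: inj_image_mem_iff)
  show ?thesis
  proof (rule set_eqI, rule iffI)
    fix a assume "a \<in> truncated_averages \<beta>' f K (t K + x)"
    then obtain Q k where "a = average f Q" and k: "\<bar>k\<bar> \<le> int K"
      and "Q \<in> dyadic_cubes \<beta>' k" "t K + x \<in> Q"
      unfolding truncated_averages_def by (elim CollectE exE conjE)
    moreover obtain R where "R \<in> dyadic_cubes \<beta> k" "Q = (+) (t K) ` R"
      using \<open>Q \<in> dyadic_cubes \<beta>' k\<close> unfolding cubes[OF k] by (elim imageE)
    ultimately have "a = average (\<lambda>y. f (t K + y)) R" "R \<in> dyadic_cubes \<beta> k" "x \<in> R"
      by (simp_all add: average_plus_image mem)
    with k show "a \<in> truncated_averages \<beta> (\<lambda>y. f (t K + y)) K x"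
      unfolding truncated_averages_def by (intro CollectI exI conjI)
  next
    fix a assume "a \<in> truncated_averages \<beta> (\<lambda>y. f (t K + y)) K x"
    then obtain R k where "a = average (\<lambda>y. f (t K + y)) R" and k: "\<bar>k\<bar> \<le> int K"
      and R: "R \<in> dyadic_cubes \<beta> k" "x \<in> R"
      unfolding truncated_averages_def by (elim CollectE exE conjE)
    then have "a = average f ((+) (t K) ` R)" "t K + x \<in> (+) (t K) ` R"
      by (simp_all add: average_plus_image mem)
    moreover have "(+) (t K) ` R \<in> dyadic_cubes \<beta>' k"
      unfolding cubes[OF k] using R(1) by (rule imageI)
    ultimately show "a \<in> truncated_averages \<beta>' f K (t K + x)"
      unfolding truncated_averages_def using k by (intro CollectI exI conjI)
  qed
qed

section \<open>Measurability of the truncated maximal function\<close>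

lemma mem_scaled_unit_cube_iff:
  fixes m s :: "real ^ 'n"
  assumes "0 < c"
  shows "x \<in> (\<lambda>y. c *\<^sub>R (y + m) + s) ` half_open_unit_cube \<longleftrightarrow>
    (\<forall>i. c * m $ i \<le> (x - s) $ i \<and> (x - s) $ i < c * (m $ i + 1))"
proof
  assume "x \<in> (\<lambda>y. c *\<^sub>R (y + m) + s) ` half_open_unit_cube"
  then show "\<forall>i. c * m $ i \<le> (x - s) $ i \<and> (x - s) $ i < c * (m $ i + 1)"
    using assms by (auto simp: half_open_unit_cube_def)
next
  assume *: "\<forall>i. c * m $ i \<le> (x - s) $ i \<and> (x - s) $ i < c * (m $ i + 1)"
  define y where "y = (1 / c) *\<^sub>R (x - s) - m"
  have "y \<in> half_open_unit_cube"
    unfolding half_open_unit_cube_def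
  proof (safe)
    fix i
    show "0 \<le> y $ i" "y $ i < 1"
      using *[rule_format, of i] assms by (simp_all add: y_def field_simps)
  qed
  moreover have "x = c *\<^sub>R (y + m) + s"
    using assms by (simp add: y_def)
  ultimately show "x \<in> (\<lambda>y. c *\<^sub>R (y + m) + s) ` half_open_unit_cube"
    by blast
qed

text \<open>
  The truncated maximal function takes at \<open>x\<close> the same value as at the corner of the
  generation-\<open>K\<close> cube containing \<open>x\<close>, hence it factors through a countable discrete space.
\<close>

lemma measurable_truncated_averages:
  fixes \<beta> :: "int \<Rightarrow> real ^ 'n" and G :: "'x::real_normed_vector set \<Rightarrow> ennreal"
  assumes "\<beta> \<in> dyadic_params"
  shows "(\<lambda>x. G (truncated_averages \<beta> f K x)) \<in> borel_measurable lebesgue"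
proof -
  define s where "s = dyadic_shift \<beta> (- int K)"
  \<comment> \<open>\<open>z x\<close> is the integer index of the generation-\<open>K\<close> cube
    containing \<open>x\<close>, relative to the offset \<open>s\<close>; \<open>corner\<close>
    recovers the lower corner of that cube.\<close>
  define z :: "real ^ 'n \<Rightarrow> int ^ 'n" where "z x = (\<chi> i. \<lfloor>2 ^ K * (x - s) $ i\<rfloor>)" for x
  define corner :: "int ^ 'n \<Rightarrow> real ^ 'n" where "corner v = s + (\<chi> i. of_int (v $ i) / 2 ^ K)" for v
  \<comment> \<open>An integer threshold cannot separate a number from its floor.\<close>
  have floor: "of_int a \<le> u \<longleftrightarrow> of_int a \<le> real_of_int \<lfloor>u\<rfloor>"
      "u < of_int a \<longleftrightarrow> real_of_int \<lfloor>u\<rfloor> < of_int a" for a and u :: real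
    by (simp_all add: le_floor_iff floor_less_iff)
  have mem: "x \<in> Q \<longleftrightarrow> corner (z x) \<in> Q" if cube: "Q \<in> dyadic_cubes \<beta> k" and "\<bar>k\<bar> \<le> int K" for Q k x
  proof -
    have k: "- int K \<le> k"
      using that(2) by simp
    obtain m where Q: "Q = (\<lambda>y. (2 powi (- k)) *\<^sub>R (y + m) + s) ` half_open_unit_cube"
        and m: "\<forall>i. m $ i \<in> \<int>"
      using cube unfolding dyadic_cubes_eq[OF assms k] s_def[symmetric] by (elim imageE CollectE)
    \<comment> \<open>The side length of \<open>Q\<close> in units of \<open>2^-K\<close>. By
      \<open>k \<le> K\<close> it is an integer, so the scaled endpoints \<open>c * a\<close> and
      \<open>c * (a + 1)\<close> are integer thresholds.\<close>
    define c :: int where "c = 2 ^ nat (int K - k)"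
    have c: "2 powi (- k) * (2 ^ K) = real_of_int c"
    proof -
      have "2 powi (- k) * (2 ^ K) = (2::real) powi (int K - k)"
        by (simp flip: power_int_add power_int_of_nat)
      also have "\<dots> = real_of_int c"
        using that(2) by (simp add: c_def power_int_def)
      finally show ?thesis .
    qed
    have iff: "(2 powi (- k) * m $ i \<le> u \<and> u < 2 powi (- k) * (m $ i + 1)) \<longleftrightarrow>
        (2 powi (- k) * m $ i \<le> of_int \<lfloor>2 ^ K * u\<rfloor> / 2 ^ K \<and>
         of_int \<lfloor>2 ^ K * u\<rfloor> / 2 ^ K < 2 powi (- k) * (m $ i + 1))" for i u
    proof -
      obtain a where a: "m $ i = of_int a"
        using m by (meson Ints_cases)
      have 1: "2 powi (- k) * m $ i \<le> v \<longleftrightarrow> of_int (c * a) \<le> 2 ^ K * v" for v :: real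
        unfolding a of_int_mult c[symmetric]
        using mult_le_cancel_left_pos[of "2 ^ K" "2 powi (- k) * real_of_int a" v] by (simp add: ac_simps)
      have 2: "v < 2 powi (- k) * (m $ i + 1) \<longleftrightarrow> 2 ^ K * v < of_int (c * (a + 1))" for v :: real
        unfolding a of_int_mult c[symmetric]
        using mult_less_cancel_left_pos[of "2 ^ K" v "2 powi (- k) * (real_of_int a + 1)"] by (simp add: ac_simps)
      show ?thesis
        unfolding 1 2 using floor(1)[of "c * a" "2 ^ K * u"] floor(2)[of "2 ^ K * u" "c * (a + 1)"]
        by simp
    qed
    show ?thesis
      unfolding Q using iff by (simp add: mem_scaled_unit_cube_iff corner_def z_def)
  qed
  have eq: "truncated_averages \<beta> f K x = truncated_averages \<beta> f K (corner (z x))" for x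
    unfolding truncated_averages_def using mem by blast
  have [measurable]: "(\<lambda>x. (x - s) $ i) \<in> borel_measurable borel" for i
    by (intro borel_measurable_continuous_onI continuous_intros)
  have "z \<in> borel \<rightarrow>\<^sub>M count_space UNIV"
  proof (subst measurable_count_space_eq2_countable, safe)
    fix v
    have "z -` {v} \<inter> space borel = {x\<in>space borel. \<forall>i. \<lfloor>2 ^ K * (x - s) $ i\<rfloor> = v $ i}"
      by (auto simp: z_def vec_eq_iff)
    also have "\<dots> \<in> sets borel"
      by measurable
    finally show "z -` {v} \<inter> space borel \<in> sets borel" .
  qed auto
  then have "z \<in> lebesgue \<rightarrow>\<^sub>M count_space UNIV"
    by (simp add: measurable_completion)
  \<comment> \<open>Every function on a discrete space is measurable, which allows an arbitrary
    \<open>G\<close>.\<close>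
  then have "(\<lambda>x. G (truncated_averages \<beta> f K (corner (z x)))) \<in> borel_measurable lebesgue"
    by (rule measurable_compose) simp
  then show ?thesis
    by (simp flip: eq)
qed

section \<open>Transfer of the bound between dyadic systems\<close>

text \<open>The translation varies with the truncation level, so the bound \<open>D\<close> is
  assumed uniformly over all translates of \<open>f\<close>; monotone convergence then removes the
  truncation.\<close>

lemma lp_norm_rademacher_maximal_le:
  fixes smul :: "'k::real_normed_field \<Rightarrow> 'x::banach \<Rightarrow> 'x" and \<beta> \<beta>' :: "int \<Rightarrow> real ^ 'n"
  assumes p: "0 < p" and \<beta>: "\<beta> \<in> dyadic_params" "\<beta>' \<in> dyadic_params"
    and D: "\<And>t. lp_norm p (rademacher_maximal smul \<beta> (\<lambda>x. f (t + x))) \<le> D"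
  shows "lp_norm p (rademacher_maximal smul \<beta>' f) \<le> D"
proof -
  let ?M = "\<lambda>\<beta> f K x. R_bound smul (truncated_averages \<beta> f K x)"
  have "(\<integral>\<^sup>+x. ennreal_powr (rademacher_maximal smul \<beta>' f x) p \<partial>lebesgue) =
      (\<integral>\<^sup>+x. (SUP K. ennreal_powr (?M \<beta>' f K x) p) \<partial>lebesgue)"
    using p by (simp add: rademacher_maximal_eq_SUP ennreal_powr_SUP)
  also have "\<dots> = (SUP K. \<integral>\<^sup>+x. ennreal_powr (?M \<beta>' f K x) p \<partial>lebesgue)"
  proof (rule nn_integral_monotone_convergence_SUP)
    show "incseq (\<lambda>K x. ennreal_powr (?M \<beta>' f K x) p)"
      using p incseq_truncated_averages[of \<beta>' f]
      by (intro monoI le_funI ennreal_powr_mono R_bound_mono) (auto dest: incseqD)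
    show "(\<lambda>x. ennreal_powr (?M \<beta>' f K x) p) \<in> borel_measurable lebesgue" for K
      by (rule measurable_truncated_averages[OF \<beta>(2), of "\<lambda>S. ennreal_powr (R_bound smul S) p"])
  qed
  also have "\<dots> \<le> ennreal_powr D p"
  proof (rule SUP_least)
    fix K
    define t where "t = dyadic_shift \<beta>' (- int K) - dyadic_shift \<beta> (- int K)"
    \<comment> \<open>Substituting \<open>t + x\<close> for \<open>x\<close> keeps the integral and
      exchanges the system \<open>\<beta>'\<close> for \<open>\<beta>\<close> at the cost of
      translating \<open>f\<close>.\<close>
    have "(\<integral>\<^sup>+x. ennreal_powr (?M \<beta>' f K x) p \<partial>lebesgue) =
        (\<integral>\<^sup>+x. ennreal_powr (?M \<beta> (\<lambda>x. f (t + x)) K x) p \<partial>lebesgue)"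
      using truncated_averages_translate[OF \<beta>, of f K]
        nn_integral_lebesgue_plus[of "\<lambda>x. ennreal_powr (?M \<beta>' f K x) p" t]
      by (simp add: t_def)
    also have "\<dots> \<le> (\<integral>\<^sup>+x. ennreal_powr (rademacher_maximal smul \<beta> (\<lambda>x. f (t + x)) x) p \<partial>lebesgue)"
      using p unfolding rademacher_maximal_eq_SUP
      by (intro nn_integral_mono ennreal_powr_mono SUP_upper) auto
    also have "\<dots> \<le> ennreal_powr D p"
      using D[of t] p by (simp add: lp_norm_le_iff)
    finally show "(\<integral>\<^sup>+x. ennreal_powr (?M \<beta>' f K x) p \<partial>lebesgue) \<le> ennreal_powr D p" .
  qed
  finally show ?thesis
    using p by (simp add: lp_norm_le_iff)
qed

theorem theorem3:
  fixes smul :: "'k::real_normed_field \<Rightarrow> 'x::banach \<Rightarrow> 'x"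
    and p :: real
  assumes "banach_scalars smul"
    and "1 < p"
    and "\<exists>\<beta> \<in> (dyadic_params :: (int \<Rightarrow> real ^ 'n) set). rademacher_maximal_lp_bounded smul p \<beta>"
  shows "\<forall>\<beta>' \<in> (dyadic_params :: (int \<Rightarrow> real ^ 'n) set). rademacher_maximal_lp_bounded smul p \<beta>'"
proof
  fix \<beta>' :: "int \<Rightarrow> real ^ 'n"
  assume \<beta>': "\<beta>' \<in> dyadic_params"
  obtain \<beta> :: "int \<Rightarrow> real ^ 'n" and C :: real where \<beta>: "\<beta> \<in> dyadic_params" and "0 \<le> C"
    and C: "\<And>f. f \<in> bochner_lp p \<Longrightarrow>
      lp_norm p (rademacher_maximal smul \<beta> f) \<le> ennreal C * bochner_lp_norm p f"
    using assms(3) unfolding rademacher_maximal_lp_bounded_def by blast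
  \<comment> \<open>All translates of \<open>f\<close> have the same norm, so the bound for
    \<open>\<beta>\<close> supplies one right-hand side for all of them and the constant
    \<open>C\<close> is kept.\<close>
  have "lp_norm p (rademacher_maximal smul \<beta>' f) \<le> ennreal C * bochner_lp_norm p f"
    if "f \<in> bochner_lp p" for f
    using assms(2) C[OF bochner_lp_plus[OF that]]
    by (intro lp_norm_rademacher_maximal_le[OF _ \<beta> \<beta>']) (simp_all add: bochner_lp_norm_plus)
  with \<open>0 \<le> C\<close> show "rademacher_maximal_lp_bounded smul p \<beta>'"
    unfolding rademacher_maximal_lp_bounded_def by blast
qed

end
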